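(* Let $N\ge1$, $\sigma\in\mathcal S_N$, $d_1,\dots,d_N\in\mathbb C$, and $A=\mathrm{diag}(d_1,\dots,d_N)+M_\sigma$. (1) If $|d_i|<1$ for all $1\le i\le N$, then with $\epsilon_N=1-\max_{1\le i\le N}|d_i|$ one has $s_{\min}(A)\ge\frac{1}{2\sqrt2}\,\epsilon_N$. (2) If $|d_i|>1$ for all $1\le i\le N$, then with $\epsilon_N=\min_{1\le i\le N}|d_i|-1$ one has $s_{\min}(A)\ge\frac{1}{2\sqrt2}\,\epsilon_N$.
   Context: $\mathcal S_N$ is the symmetric group on $\{1,\dots,N\}$. $M_\sigma$ is the $N\times N$ permutation matrix with $M_\sigma(i,j)=1$ if $\sigma(i)=j$ and $0$ otherwise. $s_{\min}$ denotes the smallest singular value. *)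

theory Defs
  imports
    "HOL-Combinatorics.Permutations"
    "Jordan_Normal_Form.Schur_Decomposition"
    "Jordan_Normal_Form.Spectral_Radius"
begin

text \<open>Matrix indices start at 0, whereas permutations and diagonal entries are indexed by
  \<open>{1..N}\<close>; hence the shift by one below.\<close>

definition perm_matrix :: "nat \<Rightarrow> (nat \<Rightarrow> nat) \<Rightarrow> complex mat" where
  "perm_matrix N \<sigma> = mat N N (\<lambda>(i, j). if \<sigma> (i + 1) = j + 1 then 1 else 0)"

definition diag_matrix :: "nat \<Rightarrow> (nat \<Rightarrow> complex) \<Rightarrow> complex mat" where
  "diag_matrix N d = mat_diag N (\<lambda>i. d (i + 1))"

text \<open>The singular values of \<open>A\<close> are the nonnegative square roots of the eigenvalues of
  \<open>A\<^sup>* A\<close>, here collected without multiplicity. For a square matrix of positive dimension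
  this set is finite and nonempty, so that \<open>Min\<close> is its least element.\<close>

definition singular_values :: "complex mat \<Rightarrow> real set" where
  "singular_values A =
     {s. 0 \<le> s \<and> complex_of_real (s\<^sup>2) \<in> spectrum (mat_adjoint A * A)}"

definition smin :: "complex mat \<Rightarrow> real" where
  "smin A = Min (singular_values A)"

end

theory Submission
  imports Defs "HOL-Analysis.L2_Norm"
begin

text \<open>A permutation matrix \<open>M\<close> preserves the Euclidean norm, so each vector \<open>v\<close> satisfies
  \<open>\<parallel>(D + M) v\<parallel> \<ge> \<bar>\<parallel>D v\<parallel> - \<parallel>v\<parallel>\<bar>\<close>, where \<open>D\<close> is the diagonal part. If all diagonal entries have
  modulus at most \<open>a < 1\<close>, then \<open>\<parallel>D v\<parallel> \<le> a \<parallel>v\<parallel>\<close>, and if all have modulus at least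
  \<open>b > 1\<close>, then \<open>\<parallel>D v\<parallel> \<ge> b \<parallel>v\<parallel>\<close>. Hence \<open>\<parallel>A v\<parallel>\<close> is at least \<open>(1 - a) \<parallel>v\<parallel>\<close> or
  \<open>(b - 1) \<parallel>v\<parallel>\<close>, respectively (\<open>diag_plus_perm_expands\<close>).

  A bound \<open>\<parallel>A v\<parallel> \<ge> c \<parallel>v\<parallel>\<close> valid for all \<open>v\<close> yields \<open>smin A \<ge> c\<close>
  (\<open>smin_lower_bound\<close>): if \<open>v\<close> is an eigenvector of \<open>A\<^sup>* A\<close> for \<open>s\<^sup>2\<close>, then
  \<open>\<parallel>A v\<parallel> = s \<parallel>v\<parallel>\<close>. This gives the theorem even with constant 1 in place of
  \<open>1 / (2 * sqrt 2)\<close>.\<close>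

section \<open>Euclidean norm and adjoint\<close>

definition vec_norm2 :: "complex vec \<Rightarrow> real" where
  "vec_norm2 v = L2_set (\<lambda>i. cmod (v $ i)) {0..<dim_vec v}"

lemma vec_norm2_pos:
  assumes "v \<in> carrier_vec n" "v \<noteq> 0\<^sub>v n"
  shows "vec_norm2 v > 0"
proof -
  obtain i where "i < n" "v $ i \<noteq> 0"
    using assms by (metis carrier_vecD eq_vecI index_zero_vec)
  then have "vec_norm2 v \<noteq> 0"
    using assms by (auto simp: vec_norm2_def L2_set_eq_0_iff)
  then show ?thesis
    using L2_set_nonneg[of "\<lambda>i. cmod (v $ i)" "{0..<dim_vec v}"] by (simp add: vec_norm2_def less_le)
qed

lemma vec_norm2_cscalar_prod: "v \<bullet>c v = complex_of_real ((vec_norm2 v)\<^sup>2)"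
proof -
  have "(vec_norm2 v)\<^sup>2 = (\<Sum>i = 0..<dim_vec v. (cmod (v $ i))\<^sup>2)"
    by (simp add: vec_norm2_def L2_set_def sum_nonneg)
  then have "complex_of_real ((vec_norm2 v)\<^sup>2) = (\<Sum>i = 0..<dim_vec v. v $ i * cnj (v $ i))"
    by (simp only: of_real_sum complex_norm_square)
  then show ?thesis
    by (simp only: scalar_prod_def dim_vec_conjugate) simp
qed

lemma mat_adjoint_carrier:
  assumes "A \<in> carrier_mat m n"
  shows "mat_adjoint A \<in> carrier_mat n m"
  using assms by (intro carrier_matI) (simp_all add: mat_adjoint_def)

lemma cscalar_prod_mat_adjoint:
  fixes A :: "complex mat"
  assumes A: "A \<in> carrier_mat m n" and v: "v \<in> carrier_vec n" and w: "w \<in> carrier_vec m"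
  shows "(mat_adjoint A *\<^sub>v w) \<bullet>c v = w \<bullet>c (A *\<^sub>v v)"
proof -
  have row: "(mat_adjoint A *\<^sub>v w) $ i = (\<Sum>k = 0..<m. cnj (A $$ (k, i)) * w $ k)"
    if "i < n" for i
    using that A w by (simp add: mat_adjoint_def scalar_prod_def)
  have "(mat_adjoint A *\<^sub>v w) \<bullet>c v
      = (\<Sum>i = 0..<n. (\<Sum>k = 0..<m. cnj (A $$ (k, i)) * w $ k) * cnj (v $ i))"
    using v row by (simp add: scalar_prod_def)
  also have "\<dots> = (\<Sum>k = 0..<m. \<Sum>i = 0..<n. cnj (A $$ (k, i)) * w $ k * cnj (v $ i))"
    unfolding sum_distrib_right by (rule sum.swap)
  also have "\<dots> = w \<bullet>c (A *\<^sub>v v)"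
    using A v by (simp add: scalar_prod_def sum_distrib_left mult_ac)
  finally show ?thesis .
qed

lemma eigenvector_gram_norm:
  assumes A: "A \<in> carrier_mat m n" and ev: "eigenvector (mat_adjoint A * A) v k"
  shows "v \<in> carrier_vec n" "vec_norm2 v > 0"
    and "k * complex_of_real ((vec_norm2 v)\<^sup>2) = complex_of_real ((vec_norm2 (A *\<^sub>v v))\<^sup>2)"
proof -
  have adj: "mat_adjoint A \<in> carrier_mat n m"
    using A by (rule mat_adjoint_carrier)
  show v: "v \<in> carrier_vec n" and "vec_norm2 v > 0"
    using ev adj vec_norm2_pos by (auto simp: eigenvector_def)
  have "mat_adjoint A *\<^sub>v (A *\<^sub>v v) = k \<cdot>\<^sub>v v"
    using ev assoc_mult_mat_vec[OF adj A v] by (simp add: eigenvector_def)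
  then have "k * (v \<bullet>c v) = (A *\<^sub>v v) \<bullet>c (A *\<^sub>v v)"
    using cscalar_prod_mat_adjoint[OF A v, of "A *\<^sub>v v"] A v by simp
  then show "k * complex_of_real ((vec_norm2 v)\<^sup>2) = complex_of_real ((vec_norm2 (A *\<^sub>v v))\<^sup>2)"
    by (simp add: vec_norm2_cscalar_prod)
qed

section \<open>The smallest singular value\<close>

text \<open>The Rayleigh quotient \<open>\<parallel>A v\<parallel>\<^sup>2 / \<parallel>v\<parallel>\<^sup>2\<close> at an eigenvector of \<open>A\<^sup>* A\<close> is the eigenvalue,
  so every eigenvalue is the square of a nonnegative real number. As squaring is injective on the
  nonnegative reals, the set of singular values is in bijection with the spectrum of \<open>A\<^sup>* A\<close>.\<close>

lemma singular_values_finite_nonempty: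
  assumes A: "A \<in> carrier_mat n n" and n: "n > 0"
  shows "finite (singular_values A)" "singular_values A \<noteq> {}"
proof -
  have gram: "mat_adjoint A * A \<in> carrier_mat n n"
    using A mat_adjoint_carrier[OF A] by simp
  have "inj_on (\<lambda>s. complex_of_real (s\<^sup>2)) (singular_values A)"
    by (auto simp: inj_on_def singular_values_def simp del: of_real_power)
  moreover have "(\<lambda>s. complex_of_real (s\<^sup>2)) ` singular_values A \<subseteq> spectrum (mat_adjoint A * A)"
    by (auto simp: singular_values_def)
  ultimately show "finite (singular_values A)"
    using card_finite_spectrum(1)[OF gram] by (meson inj_on_finite)
  obtain k v where ev: "eigenvector (mat_adjoint A * A) v k"
    using spectrum_non_empty[OF gram n] by (auto simp: spectrum_def eigenvalue_def)
  define s where "s = vec_norm2 (A *\<^sub>v v) / vec_norm2 v"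
  have "k = complex_of_real (s\<^sup>2)"
    using eigenvector_gram_norm[OF A ev] by (simp add: s_def power_divide field_simps)
  moreover have "s \<ge> 0"
    by (simp add: s_def vec_norm2_def)
  ultimately have "s \<in> singular_values A"
    using ev by (auto simp: singular_values_def spectrum_def eigenvalue_def)
  then show "singular_values A \<noteq> {}"
    by auto
qed

lemma smin_lower_bound:
  assumes A: "A \<in> carrier_mat n n" and n: "n > 0"
    and bound: "\<And>v. v \<in> carrier_vec n \<Longrightarrow> c * vec_norm2 v \<le> vec_norm2 (A *\<^sub>v v)"
  shows "c \<le> smin A"
proof -
  have "c \<le> s" if s: "s \<in> singular_values A" for s
  proof -
    have "s \<ge> 0"
      using s by (simp add: singular_values_def)
    obtain v where ev: "eigenvector (mat_adjoint A * A) v (complex_of_real (s\<^sup>2))"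
      using s by (auto simp: singular_values_def spectrum_def eigenvalue_def)
    note v = eigenvector_gram_norm[OF A ev]
    have "(s * vec_norm2 v)\<^sup>2 = (vec_norm2 (A *\<^sub>v v))\<^sup>2"
      using v(3) unfolding of_real_mult[symmetric] of_real_eq_iff by (simp add: power_mult_distrib)
    then have "vec_norm2 (A *\<^sub>v v) = s * vec_norm2 v"
      using \<open>s \<ge> 0\<close> v(2) by (simp add: vec_norm2_def power2_eq_iff_nonneg)
    then show ?thesis
      using bound[OF v(1)] v(2) by simp
  qed
  then show ?thesis
    unfolding smin_def by (intro Min.boundedI singular_values_finite_nonempty[OF A n])
qed

section \<open>Diagonal plus permutation matrices\<close>

lemma diag_plus_perm_carrier: "diag_matrix N d + perm_matrix N \<sigma> \<in> carrier_mat N N"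
  unfolding perm_matrix_def by (rule add_carrier_mat) (rule mat_carrier)

lemma diag_plus_perm_mult_vec:
  assumes \<sigma>: "\<sigma> permutes {1..N}" and v: "v \<in> carrier_vec N" and i: "i < N"
  shows "((diag_matrix N d + perm_matrix N \<sigma>) *\<^sub>v v) $ i
    = d (i + 1) * v $ i + v $ (\<sigma> (i + 1) - 1)"
proof -
  have "\<sigma> (i + 1) \<in> {1..N}"
    using permutes_in_image[OF \<sigma>, of "i + 1"] i by simp
  then have \<sigma>i: "\<sigma> (i + 1) - 1 < N"
    and iff: "\<sigma> (i + 1) = j + 1 \<longleftrightarrow> j = \<sigma> (i + 1) - 1" for j
    by auto
  let ?A = "diag_matrix N d + perm_matrix N \<sigma>"
  have entry: "?A $$ (i, j)
      = (if j = i then d (i + 1) else 0) + (if j = \<sigma> (i + 1) - 1 then 1 else 0)"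
    if "j < N" for j
  proof -
    have "?A $$ (i, j)
        = (if i = j then d (i + 1) else 0) + (if \<sigma> (i + 1) = j + 1 then 1 else 0)"
      using i that by (simp add: diag_matrix_def perm_matrix_def mat_diag_def)
    then show ?thesis
      by (simp only: iff eq_commute[of i j])
  qed
  have "(?A *\<^sub>v v) $ i = (\<Sum>j = 0..<N. ?A $$ (i, j) * v $ j)"
  proof -
    have dim: "dim_row ?A = N" "dim_col ?A = N"
      using diag_plus_perm_carrier[of N d \<sigma>] by (rule carrier_matD)+
    have "(?A *\<^sub>v v) $ i = row ?A i \<bullet> v"
      using i dim by (intro index_mult_mat_vec) simp
    also have "\<dots> = (\<Sum>j = 0..<N. ?A $$ (i, j) * v $ j)"
      unfolding scalar_prod_def carrier_vecD[OF v]
      using i dim by (intro sum.cong[OF refl]) (simp only: index_row atLeastLessThan_iff)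
    finally show ?thesis .
  qed
  also have "\<dots> = (\<Sum>j = 0..<N. (if j = i then d (i + 1) * v $ j else 0)
      + (if j = \<sigma> (i + 1) - 1 then v $ j else 0))"
    by (rule sum.cong[OF refl], subst entry) (simp_all add: distrib_right)
  also have "\<dots> = d (i + 1) * v $ i + v $ (\<sigma> (i + 1) - 1)"
    using i \<sigma>i by (simp add: sum.distrib)
  finally show ?thesis .
qed

lemma L2_set_permuted:
  fixes N :: nat
  assumes \<sigma>: "\<sigma> permutes {1..N}"
  shows "L2_set (\<lambda>i. f (\<sigma> (i + 1) - 1)) {0..<N} = L2_set f {0..<N}"
proof -
  have "(\<Sum>i = 0..<N. (f (\<sigma> (i + 1) - 1))\<^sup>2) = (\<Sum>j\<in>{1..N}. (f (\<sigma> j - 1))\<^sup>2)"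
    by (rule sum.reindex_bij_witness[of _ "\<lambda>j. j - 1" "\<lambda>i. i + 1"]) auto
  also have "\<dots> = (\<Sum>j\<in>{1..N}. (f (j - 1))\<^sup>2)"
    using sum.permute[OF \<sigma>, of "\<lambda>j. (f (j - 1))\<^sup>2"] by (simp add: comp_def)
  also have "\<dots> = (\<Sum>i = 0..<N. (f i)\<^sup>2)"
    by (rule sum.reindex_bij_witness[of _ "\<lambda>i. i + 1" "\<lambda>j. j - 1"]) auto
  finally show ?thesis
    by (simp add: L2_set_def)
qed

text \<open>With \<open>\<tau>\<close> the permutation of the indices, the entries satisfy
  \<open>(A v)\<^sub>i = d\<^sub>i v\<^sub>i + v\<^bsub>\<tau> i\<^esub>\<close>. For the first bound, estimate the second summand by the first
  and \<open>(A v)\<^sub>i\<close>; for the other bound, estimate the first summand by the second and \<open>(A v)\<^sub>i\<close>.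
  Minkowski's inequality turns these entrywise estimates into estimates of norms, and
  \<open>\<tau>\<close> does not change the norm of \<open>v\<close>.\<close>

lemma diag_plus_perm_expands:
  fixes d :: "nat \<Rightarrow> complex"
  assumes \<sigma>: "\<sigma> permutes {1..N}" and v: "v \<in> carrier_vec N"
  defines "A \<equiv> diag_matrix N d + perm_matrix N \<sigma>"
  shows "(\<And>i. i \<in> {1..N} \<Longrightarrow> cmod (d i) \<le> a) \<Longrightarrow> 0 \<le> a
      \<Longrightarrow> (1 - a) * vec_norm2 v \<le> vec_norm2 (A *\<^sub>v v)"
    and "(\<And>i. i \<in> {1..N} \<Longrightarrow> b \<le> cmod (d i)) \<Longrightarrow> 0 \<le> b
      \<Longrightarrow> (b - 1) * vec_norm2 v \<le> vec_norm2 (A *\<^sub>v v)"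
proof -
  let ?I = "{0..<N}"
  let ?w = "\<lambda>i. cmod ((A *\<^sub>v v) $ i)" and ?v = "\<lambda>i. cmod (v $ i)"
  let ?p = "\<lambda>i. cmod (v $ (\<sigma> (i + 1) - 1))"
  have nv: "vec_norm2 v = L2_set ?v ?I"
    using v by (simp add: vec_norm2_def)
  have nw: "vec_norm2 (A *\<^sub>v v) = L2_set ?w ?I"
    unfolding vec_norm2_def A_def dim_mult_mat_vec carrier_matD(1)[OF diag_plus_perm_carrier] ..
  have np: "L2_set ?p ?I = L2_set ?v ?I"
    using L2_set_permuted[OF \<sigma>, of ?v] .
  have Av: "(A *\<^sub>v v) $ i = d (i + 1) * v $ i + v $ (\<sigma> (i + 1) - 1)" if "i < N" for i
    unfolding A_def using diag_plus_perm_mult_vec[OF \<sigma> v that] .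
  show "(1 - a) * vec_norm2 v \<le> vec_norm2 (A *\<^sub>v v)"
    if d: "\<And>i. i \<in> {1..N} \<Longrightarrow> cmod (d i) \<le> a" and a: "0 \<le> a"
  proof -
    have "?p i \<le> ?w i + a * ?v i" if "i \<in> ?I" for i
    proof -
      have "?p i = cmod ((A *\<^sub>v v) $ i - d (i + 1) * v $ i)"
        using Av that by simp
      also have "\<dots> \<le> ?w i + cmod (d (i + 1)) * ?v i"
        using norm_triangle_ineq4[of "(A *\<^sub>v v) $ i" "d (i + 1) * v $ i"] by (simp add: norm_mult)
      also have "\<dots> \<le> ?w i + a * ?v i"
        using d[of "i + 1"] that by (simp add: mult_right_mono)
      finally show ?thesis .
    qed
    then have "L2_set ?p ?I \<le> L2_set (\<lambda>i. ?w i + a * ?v i) ?I"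
      by (intro L2_set_mono) auto
    also have "\<dots> \<le> L2_set ?w ?I + a * L2_set ?v ?I"
      using L2_set_triangle_ineq[of ?w "\<lambda>i. a * ?v i" ?I] a by (simp add: L2_set_right_distrib)
    finally show ?thesis
      unfolding nv nw np by (simp add: algebra_simps)
  qed
  show "(b - 1) * vec_norm2 v \<le> vec_norm2 (A *\<^sub>v v)"
    if d: "\<And>i. i \<in> {1..N} \<Longrightarrow> b \<le> cmod (d i)" and b: "0 \<le> b"
  proof -
    have "b * ?v i \<le> ?w i + ?p i" if "i \<in> ?I" for i
    proof -
      have "b * ?v i \<le> cmod (d (i + 1)) * ?v i"
        using d[of "i + 1"] that by (simp add: mult_right_mono)
      also have "\<dots> = cmod ((A *\<^sub>v v) $ i - v $ (\<sigma> (i + 1) - 1))"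
        using Av that by (simp add: norm_mult)
      also have "\<dots> \<le> ?w i + ?p i"
        by (rule norm_triangle_ineq4)
      finally show ?thesis .
    qed
    then have "L2_set (\<lambda>i. b * ?v i) ?I \<le> L2_set (\<lambda>i. ?w i + ?p i) ?I"
      using b by (intro L2_set_mono) auto
    also have "\<dots> \<le> L2_set ?w ?I + L2_set ?p ?I"
      by (rule L2_set_triangle_ineq)
    finally show ?thesis
      unfolding nv nw np L2_set_right_distrib[OF b, symmetric] by (simp add: algebra_simps)
  qed
qed

theorem theorem1p2:
  fixes N :: nat and \<sigma> :: "nat \<Rightarrow> nat" and d :: "nat \<Rightarrow> complex" and A :: "complex mat"
  assumes "N \<ge> 1"
    and "\<sigma> permutes {1..N}"
    and "A = diag_matrix N d + perm_matrix N \<sigma>"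
  shows "((\<forall>i\<in>{1..N}. cmod (d i) < 1) \<longrightarrow>
            smin A \<ge> 1 / (2 * sqrt 2) * (1 - (MAX i\<in>{1..N}. cmod (d i))))
       \<and> ((\<forall>i\<in>{1..N}. cmod (d i) > 1) \<longrightarrow>
            smin A \<ge> 1 / (2 * sqrt 2) * ((MIN i\<in>{1..N}. cmod (d i)) - 1))"
proof (intro conjI impI)
  have N: "N > 0"
    using assms(1) by simp
  have "1 \<le> sqrt 2"
    by simp
  then have "1 \<le> 2 * sqrt 2"
    by linarith
  then have "1 / (2 * sqrt 2) \<le> 1"
    by simp
  then have weaken: "1 / (2 * sqrt 2) * c \<le> c" if "c \<ge> 0" for c :: real
    using mult_right_mono[OF _ that, of "1 / (2 * sqrt 2)" 1] by simp
  let ?S = "(\<lambda>i. cmod (d i)) ` {1..N}"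
  have S: "finite ?S" "?S \<noteq> {}"
    using N by auto
  show "1 / (2 * sqrt 2) * (1 - Max ?S) \<le> smin A" if small: "\<forall>i\<in>{1..N}. cmod (d i) < 1"
  proof -
    have "Max ?S < 1"
      using Max_in[OF S] small by fastforce
    moreover have le: "cmod (d i) \<le> Max ?S" if "i \<in> {1..N}" for i
      using that S by simp
    moreover have "0 \<le> Max ?S"
      using order_trans[OF norm_ge_zero le[of 1]] N by simp
    ultimately have "1 - Max ?S \<le> smin A"
      unfolding assms(3)
      by (intro smin_lower_bound[OF diag_plus_perm_carrier N] diag_plus_perm_expands(1)[OF assms(2)])
    then show ?thesis
      using weaken[of "1 - Max ?S"] \<open>Max ?S < 1\<close> by linarith
  qed
  show "1 / (2 * sqrt 2) * (Min ?S - 1) \<le> smin A" if large: "\<forall>i\<in>{1..N}. cmod (d i) > 1"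
  proof -
    have "Min ?S > 1"
      using Min_in[OF S] large by fastforce
    moreover have "Min ?S \<le> cmod (d i)" if "i \<in> {1..N}" for i
      using that S by simp
    ultimately have "Min ?S - 1 \<le> smin A"
      unfolding assms(3)
      by (intro smin_lower_bound[OF diag_plus_perm_carrier N] diag_plus_perm_expands(2)[OF assms(2)])
        auto
    then show ?thesis
      using weaken[of "Min ?S - 1"] \<open>Min ?S > 1\<close> by linarith
  qed
qed

end
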